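(* Let $\lambda\in(0,\frac12)$ and $\gamma\in(0,1)$. Then the optimal $(\lambda,\gamma)$-admissible quadratic polynomial is $$p_2^{\lambda,\gamma}(x)=\begin{cases}(x-\lambda)\left(\frac{-4}{(1-\lambda+\lambda\gamma)^2}\,x+\frac{4(1+\lambda\gamma)}{(1-\lambda+\lambda\gamma)^2}\right), & \lambda\in\left(0,\frac{1}{3+2\sqrt2-\gamma}\right];\\[4pt] (x-\lambda)\left(\frac{-1}{(3+2\sqrt2)\lambda^2}\,x+\frac1\lambda\right), & \lambda\in\left[\frac{1}{3+2\sqrt2-\gamma},\,1-\frac{\sqrt2}{2}\right];\\[4pt] (x-\lambda)\left(\frac{2\lambda-1}{(1-\lambda)\lambda}\,x+\frac1\lambda\right), & \lambda\in\left[1-\frac{\sqrt2}{2},\,\frac12\right),\end{cases}$$ and the associated optimal gap is $$\alpha_2(\lambda,\gamma)=\begin{cases}\frac{4\gamma\lambda(1-\lambda)}{(1+\lambda\gamma-\lambda)^2}, & \lambda\in\left(0,\frac{1}{3+2\sqrt2-\gamma}\right];\\[4pt] \frac{\gamma}{3+2\sqrt2}\,(2+2\sqrt2-\gamma), & \lambda\in\left[\frac{1}{3+2\sqrt2-\gamma},\,1-\frac{\sqrt2}{2}\right];\\[4pt] \frac{\lambda(2\lambda-1)\gamma(1+\gamma)}{1-\lambda}+\gamma, & \lambda\in\left[1-\frac{\sqrt2}{2},\,\frac12\right).\end{cases}$$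
   Context: For $\lambda\in(0,1)$ and $\gamma\in(0,1)$ with $\lambda(1+\gamma)<1$, a real polynomial $p$ is said to be $(\lambda,\gamma)$-admissible if: (i) $p(\lambda)=0$; (ii) for all $x\in[0,(1-\gamma)\lambda]$, $-1\le p(x)\le p((1-\gamma)\lambda)<0$; and (iii) for all $x\in[(1+\gamma)\lambda,1]$, $0<p((1+\gamma)\lambda)\le p(x)\le 1$. The $(\lambda,\gamma)$-admissible gap of a $(\lambda,\gamma)$-admissible polynomial $p$ is $\alpha(p;\lambda,\gamma)=\min\{-p((1-\gamma)\lambda),\,p((1+\gamma)\lambda)\}$. The optimal $(\lambda,\gamma)$-admissible polynomial of degree $n$, denoted $p_n^{\lambda,\gamma}$, is the maximizer of $\alpha(p;\lambda,\gamma)$ over all $(\lambda,\gamma)$-admissible polynomials $p$ of degree $n$, and $\alpha_n(\lambda,\gamma)=\alpha(p_n^{\lambda,\gamma};\lambda,\gamma)$ is the corresponding maximal value (the optimal gap). "Quadratic" means of degree $2$. *)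

theory Defs
  imports Complex_Main "HOL-Computational_Algebra.Polynomial"
begin

text \<open>
  The parameter range \<open>0 < lam < 1\<close>, \<open>0 < \<gamma> < 1\<close>, \<open>lam * (1 + \<gamma>) < 1\<close> is not built into the definitions;
  it has to be assumed where they are used. In that range both intervals below are nonempty.
\<close>

definition admissible :: "real \<Rightarrow> real \<Rightarrow> real poly \<Rightarrow> bool" where
  "admissible lam \<gamma> p \<longleftrightarrow>
     poly p lam = 0 \<and>
     (\<forall>x\<in>{0..(1 - \<gamma>) * lam}.
        -1 \<le> poly p x \<and> poly p x \<le> poly p ((1 - \<gamma>) * lam) \<and> poly p ((1 - \<gamma>) * lam) < 0) \<and>
     (\<forall>x\<in>{(1 + \<gamma>) * lam..1}.
        0 < poly p ((1 + \<gamma>) * lam) \<and> poly p ((1 + \<gamma>) * lam) \<le> poly p x \<and> poly p x \<le> 1)"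

definition admissible_gap :: "real \<Rightarrow> real \<Rightarrow> real poly \<Rightarrow> real" where
  "admissible_gap lam \<gamma> p = min (- poly p ((1 - \<gamma>) * lam)) (poly p ((1 + \<gamma>) * lam))"

definition is_optimal_poly :: "nat \<Rightarrow> real \<Rightarrow> real \<Rightarrow> real poly \<Rightarrow> bool" where
  "is_optimal_poly n lam \<gamma> p \<longleftrightarrow>
     is_arg_max (admissible_gap lam \<gamma>) (\<lambda>q. admissible lam \<gamma> q \<and> degree q = n) p"

text \<open>
  The next two constants are meaningful only when the maximizer exists and is unique, so a statement
  about them should be accompanied by \<open>\<exists>!p. is_optimal_poly n lam \<gamma> p\<close>.
\<close>

definition optimal_poly :: "nat \<Rightarrow> real \<Rightarrow> real \<Rightarrow> real poly" where
  "optimal_poly n lam \<gamma> = (THE p. is_optimal_poly n lam \<gamma> p)"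

definition optimal_gap :: "nat \<Rightarrow> real \<Rightarrow> real \<Rightarrow> real" where
  "optimal_gap n lam \<gamma> = admissible_gap lam \<gamma> (optimal_poly n lam \<gamma>)"

end

theory Submission imports Defs begin

text \<open>
  A quadratic vanishing at \<open>lam\<close> is \<open>(x - lam) (b - c x)\<close>, and its gap is at most its value
  \<open>\<gamma> lam (b - c (1 + \<gamma>) lam)\<close> at \<open>(1 + \<gamma>) lam\<close>, which is linear in \<open>(b, c)\<close>. In each
  range of \<open>lam\<close>, two of the linear inequalities implied by admissibility
  bound this value, and the optimum is the point where both are tight:
  the value at 1 being at least the value at \<open>(1 + \<gamma>) lam\<close> and the bound 1 at the peak of the optimum (small \<open>lam\<close>);
  the bound -1 at 0 and the bound 1 at the peak (middle range);
  the bound -1 at 0 and the bound 1 at 1 (large \<open>lam\<close>).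
\<close>

section \<open>Quadratics with a prescribed root; existence and uniqueness of maximizers\<close>

abbreviation quad :: "real \<Rightarrow> real \<Rightarrow> real \<Rightarrow> real poly" where
  "quad lam b c \<equiv> [:- lam, 1:] * [:b, - c:]"

lemma poly_quad: "poly (quad lam b c) x = (x - lam) * (b - c * x)"
  by (simp add: algebra_simps)

lemma degree_quad: "c \<noteq> 0 \<Longrightarrow> degree (quad lam b c) = 2"
  by (subst degree_mult_eq) auto

text \<open>The factor theorem and a degree count leave a linear cofactor. Its slope is written
  \<open>- c\<close> so that \<open>c > 0\<close> is the concave case, to which all three optima
  belong.\<close>

lemma quadE:
  assumes "poly p lam = 0" and "degree p = 2"
  obtains b c where "p = quad lam b c"
proof -
  from assms(1) obtain q where q: "p = [:- lam, 1:] * q"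
    by (auto simp: poly_eq_0_iff_dvd elim: dvdE)
  then have "q \<noteq> 0"
    using assms(2) by auto
  then have "degree q = 1"
    using assms(2) by (simp add: q degree_mult_eq del: mult_pCons_left)
  then obtain a b where "q = [:b, a:]"
    by (cases q) (auto elim: degree_eq_zeroE split: if_splits)
  then have "p = quad lam b (- a)"
    using q by simp
  then show ?thesis by (rule that)
qed

text \<open>Asking every competitor to be strictly worse or equal gives uniqueness together with
  maximality, which determines the \<open>THE\<close> in \<open>optimal_poly\<close>.\<close>

lemma optimal_polyI:
  assumes "admissible lam \<gamma> p" and "degree p = n"
    and "\<And>q. admissible lam \<gamma> q \<Longrightarrow> degree q = n \<Longrightarrow>
           admissible_gap lam \<gamma> q < admissible_gap lam \<gamma> p \<or> q = p"
  shows "\<exists>!q. is_optimal_poly n lam \<gamma> q" and "optimal_poly n lam \<gamma> = p"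
proof -
  have p: "is_optimal_poly n lam \<gamma> p"
    using assms unfolding is_optimal_poly_def is_arg_max_def by (metis order_less_asym)
  moreover have unique: "q = p" if "is_optimal_poly n lam \<gamma> q" for q
    using that assms unfolding is_optimal_poly_def is_arg_max_def by blast
  ultimately show "\<exists>!q. is_optimal_poly n lam \<gamma> q" by blast
  show "optimal_poly n lam \<gamma> = p"
    unfolding optimal_poly_def using p unique by (rule the_equality)
qed

section \<open>Gap and admissibility as conditions on the coefficients\<close>

lemma gap_quad_le:
  "admissible_gap lam \<gamma> (quad lam b c) \<le> \<gamma> * lam * (b - c * ((1 + \<gamma>) * lam))"
  unfolding admissible_gap_def poly_quad by (simp add: algebra_simps)

text \<open>The identity \<open>4 c (1 - (x - lam) (b - c x)) = (2 c x - b - c lam)\<^sup>2 + 4 c - (b - c lam)\<^sup>2\<close>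
  gives the bound.\<close>

lemma quad_le_1:
  fixes b c lam x :: real
  assumes "c > 0" and "(b - c * lam)\<^sup>2 \<le> 4 * c"
  shows "(x - lam) * (b - c * x) \<le> 1"
proof -
  have "4 * c * (1 - (x - lam) * (b - c * x)) = (2 * c * x - b - c * lam)\<^sup>2 + (4 * c - (b - c * lam)\<^sup>2)"
    by (simp add: power2_eq_square algebra_simps)
  then have "0 \<le> 4 * c * (1 - (x - lam) * (b - c * x))"
    using assms(2) by simp
  then have "0 \<le> 1 - (x - lam) * (b - c * x)"
    using assms(1) by (simp only: zero_le_mult_iff) auto
  then show ?thesis by simp
qed

text \<open>The second condition in \<open>b\<close> says that the value at 1 is at least the value
  at \<open>(1 + \<gamma>) * lam\<close>; by concavity this yields every monotonicity required. The
  upper bound stays a hypothesis because it is proved differently when the vertex lies beyond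
  1.\<close>

lemma admissible_quad:
  fixes lam \<gamma> b c :: real
  assumes lam: "0 < lam" "lam < 1 / 2" and \<gamma>: "0 < \<gamma>" "\<gamma> < 1" and "c > 0"
    and b: "b * lam \<le> 1" "c * (1 + lam * \<gamma>) \<le> b"
    and le_1: "\<And>x. (1 + \<gamma>) * lam \<le> x \<Longrightarrow> x \<le> 1 \<Longrightarrow> (x - lam) * (b - c * x) \<le> 1"
  shows "admissible lam \<gamma> (quad lam b c)"
    and "admissible_gap lam \<gamma> (quad lam b c) = \<gamma> * lam * (b - c * ((1 + \<gamma>) * lam))"
proof -
  define u v where "u = (1 - \<gamma>) * lam" and "v = (1 + \<gamma>) * lam"
  have gl: "0 < \<gamma> * lam" "\<gamma> * lam < lam"
    using lam \<gamma> by simp_all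
  have uv: "0 < u" "u < v" "v < 1" "u - lam = - (\<gamma> * lam)" "v - lam = \<gamma> * lam"
    using lam gl by (auto simp: u_def v_def algebra_simps)
  have slope: "c * y \<le> b + c * lam" if "y \<le> 1 + v" for y
  proof -
    have "c * y \<le> c * (1 + v)"
      using that \<open>c > 0\<close> by simp
    also have "\<dots> = c * (1 + lam * \<gamma>) + c * lam"
      by (simp add: v_def algebra_simps)
    finally show ?thesis using b(2) by simp
  qed
  \<comment> \<open>The chord slope between \<open>x\<close> and \<open>y\<close> is
    \<open>b + c * lam - c * (x + y)\<close>, so its sign depends on \<open>x + y\<close> alone; the
    extreme case is the chord from \<open>v\<close> to 1.\<close>
  have mono: "(x - lam) * (b - c * x) \<le> (y - lam) * (b - c * y)" if "x \<le> y" "x + y \<le> 1 + v" for x y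
  proof -
    have "0 \<le> (y - x) * (b + c * lam - c * (x + y))"
      using slope[OF that(2)] that(1) by simp
    then show ?thesis by (simp add: algebra_simps)
  qed
  have "c * v < c * (1 + lam * \<gamma>)"
    using \<open>c > 0\<close> lam by (simp add: v_def algebra_simps)
  then have pos_v: "0 < b - c * v" using b(2) by simp
  moreover have "c * u < c * v" using \<open>c > 0\<close> uv by simp
  ultimately have pos_u: "0 < b - c * u" by simp
  show "admissible lam \<gamma> (quad lam b c)"
    unfolding admissible_def poly_quad u_def[symmetric] v_def[symmetric]
  proof (intro conjI ballI)
    fix x assume x: "x \<in> {0..u}"
    have "- 1 \<le> (0 - lam) * (b - c * 0)" using b(1) by (simp add: algebra_simps)
    also have "\<dots> \<le> (x - lam) * (b - c * x)" using x uv by (intro mono) auto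
    finally show "- 1 \<le> (x - lam) * (b - c * x)" .
    show "(x - lam) * (b - c * x) \<le> (u - lam) * (b - c * u)"
      using x uv by (intro mono) auto
    show "(u - lam) * (b - c * u) < 0"
      using mult_pos_pos[OF gl(1) pos_u] unfolding uv(4)
      by (simp only: mult_minus_left neg_less_0_iff_less)
  next
    fix x assume x: "x \<in> {v..1}"
    show "0 < (v - lam) * (b - c * v)"
      unfolding uv(5) using gl(1) pos_v by (rule mult_pos_pos)
    show "(v - lam) * (b - c * v) \<le> (x - lam) * (b - c * x)"
      using x by (intro mono) auto
    show "(x - lam) * (b - c * x) \<le> 1"
      using x le_1 by (simp add: v_def)
  qed simp
  \<comment> \<open>Since \<open>u\<close> and \<open>v\<close> are equally far from the root, only
    the decreasing factor \<open>b - c * x\<close> matters, and the minimum in the gap is attained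
    at \<open>v\<close>.\<close>
  have "\<gamma> * lam * (b - c * v) \<le> \<gamma> * lam * (b - c * u)"
    using \<open>c * u < c * v\<close> gl by (intro mult_left_mono) auto
  then show "admissible_gap lam \<gamma> (quad lam b c) = \<gamma> * lam * (b - c * ((1 + \<gamma>) * lam))"
    unfolding admissible_gap_def poly_quad u_def[symmetric] v_def[symmetric] uv by simp
qed

text \<open>Reduces optimality among polynomials to maximizing a linear function of the pair of
  coefficients.\<close>

lemma optimal_quad:
  fixes lam \<gamma> b c :: real
  assumes "0 < lam" "lam < 1 / 2" "0 < \<gamma>" "\<gamma> < 1" and "c > 0"
    and "b * lam \<le> 1" "c * (1 + lam * \<gamma>) \<le> b"
    and "\<And>x. (1 + \<gamma>) * lam \<le> x \<Longrightarrow> x \<le> 1 \<Longrightarrow> (x - lam) * (b - c * x) \<le> 1"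
    and best: "\<And>b' c'. admissible lam \<gamma> (quad lam b' c') \<Longrightarrow>
      b' - c' * ((1 + \<gamma>) * lam) < b - c * ((1 + \<gamma>) * lam) \<or> b' = b \<and> c' = c"
  shows "\<exists>!q. is_optimal_poly 2 lam \<gamma> q" and "optimal_poly 2 lam \<gamma> = quad lam b c"
    and "optimal_gap 2 lam \<gamma> = \<gamma> * lam * (b - c * ((1 + \<gamma>) * lam))"
proof -
  have adm: "admissible lam \<gamma> (quad lam b c)"
    "admissible_gap lam \<gamma> (quad lam b c) = \<gamma> * lam * (b - c * ((1 + \<gamma>) * lam))"
    by (rule admissible_quad; fact assms)+
  have less: "admissible_gap lam \<gamma> q < admissible_gap lam \<gamma> (quad lam b c) \<or> q = quad lam b c"
    if q: "admissible lam \<gamma> q" "degree q = 2" for q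
  proof -
    obtain b' c' where q': "q = quad lam b' c'"
      using q quadE unfolding admissible_def by metis
    then consider "b' - c' * ((1 + \<gamma>) * lam) < b - c * ((1 + \<gamma>) * lam)" | "b' = b \<and> c' = c"
      using best q(1) by metis
    then show ?thesis
    proof cases
      \<comment> \<open>The linear objective only bounds the gap of the competitor, but equals the
        gap of the candidate.\<close>
      case 1
      then have "\<gamma> * lam * (b' - c' * ((1 + \<gamma>) * lam)) < \<gamma> * lam * (b - c * ((1 + \<gamma>) * lam))"
        using assms(1,3) by (intro mult_strict_left_mono) auto
      then show ?thesis
        using gap_quad_le[of lam \<gamma> b' c'] unfolding q' adm(2) by linarith
    qed (simp add: q')
  qed
  have "degree (quad lam b c) = 2" using \<open>c > 0\<close> by (intro degree_quad) simp
  show "\<exists>!q. is_optimal_poly 2 lam \<gamma> q" and "optimal_poly 2 lam \<gamma> = quad lam b c"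
    by (rule optimal_polyI; fact)+
  then show "optimal_gap 2 lam \<gamma> = \<gamma> * lam * (b - c * ((1 + \<gamma>) * lam))"
    unfolding optimal_gap_def using adm(2) by simp
qed

text \<open>Converse to \<open>admissible_quad\<close>: the same three conditions, read off at 0,
  from comparing 1 with \<open>(1 + \<gamma>) * lam\<close>, and from the upper bound. For fixed
  \<open>x\<close> each is linear in \<open>b\<close> and \<open>c\<close>.\<close>

lemma admissible_quadD:
  assumes "admissible lam \<gamma> (quad lam b c)" and "0 < lam" "lam < 1 / 2" "0 < \<gamma>" "\<gamma> < 1"
  shows "b * lam \<le> 1" and "c * (1 + lam * \<gamma>) \<le> b"
    and "\<And>x. (1 + \<gamma>) * lam \<le> x \<Longrightarrow> x \<le> 1 \<Longrightarrow> (x - lam) * (b - c * x) \<le> 1"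
proof -
  note adm = assms(1)[unfolded admissible_def poly_quad]
  have "\<gamma> * lam < lam" using assms by simp
  then have v: "(1 + \<gamma>) * lam < 1" using assms(3) by (simp only: distrib_right)
  have "0 \<in> {0..(1 - \<gamma>) * lam}" using assms by simp
  then have "- 1 \<le> (0 - lam) * (b - c * 0)" using adm by blast
  then show "b * lam \<le> 1" by (simp add: algebra_simps)
  have "((1 + \<gamma>) * lam - lam) * (b - c * ((1 + \<gamma>) * lam)) \<le> (1 - lam) * (b - c * 1)"
  proof -
    have "1 \<in> {(1 + \<gamma>) * lam..1}" using v by simp
    then show ?thesis using adm by blast
  qed
  then have "0 \<le> (1 - (1 + \<gamma>) * lam) * (b - c * (1 + lam * \<gamma>))"
    by (simp add: algebra_simps)
  then show "c * (1 + lam * \<gamma>) \<le> b"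
    using v by (simp only: zero_le_mult_iff) auto
  show "(x - lam) * (b - c * x) \<le> 1" if "(1 + \<gamma>) * lam \<le> x" "x \<le> 1" for x
    using adm that by auto
qed

text \<open>The coefficient of \<open>c\<close> in the objective is a strict convex combination of its coefficients
  \<open>r\<close> and \<open>t\<close> in the two constraints.\<close>

lemma two_constraints_max:
  fixes b c b' c' r s t :: real
  assumes "r < s" "s < t" and "b' - c' * r \<le> b - c * r" and "b' - c' * t \<le> b - c * t"
  shows "b' - c' * s < b - c * s \<or> b' = b \<and> c' = c"
proof (cases "b' - c' * r = b - c * r \<and> b' - c' * t = b - c * t")
  case True
  then have "(c' - c) * (t - r) = 0" by (simp add: algebra_simps)
  with assms True show ?thesis by auto
next
  case False
  define d e where "d = (b - c * r) - (b' - c' * r)" and "e = (b - c * t) - (b' - c' * t)"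
  have "0 < (t - s) * d + (s - r) * e"
    using assms False unfolding d_def e_def
    by (smt (verit, best) mult_nonneg_nonneg mult_pos_pos)
  also have "\<dots> = (t - r) * ((b - c * s) - (b' - c' * s))"
    by (simp add: d_def e_def algebra_simps)
  finally show ?thesis
    using assms by (simp add: zero_less_mult_iff)
qed

section \<open>The optimum in each range of \<open>lam\<close>\<close>

lemma optimal_quad_small:
  fixes lam \<gamma> :: real
  assumes lam: "0 < lam" "lam < 1 / 2" and \<gamma>: "0 < \<gamma>" "\<gamma> < 1"
    and small: "(3 + 2 * sqrt 2 - \<gamma>) * lam \<le> 1"
  defines "d \<equiv> 1 - lam + lam * \<gamma>"
  shows "\<exists>!q. is_optimal_poly 2 lam \<gamma> q"
    and "optimal_poly 2 lam \<gamma> = quad lam (4 * (1 + lam * \<gamma>) / d\<^sup>2) (4 / d\<^sup>2)"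
    and "optimal_gap 2 lam \<gamma> = 4 * \<gamma> * lam * (1 - lam) / d\<^sup>2"
proof -
  \<comment> \<open>The second root is \<open>s\<close>, which places the vertex midway between
    \<open>v\<close> and 1, so the values there agree. The roots are \<open>d\<close> apart, and
    \<open>c = 4 / d\<^sup>2\<close> makes the peak equal to 1.\<close>
  define s c b v where "s = 1 + lam * \<gamma>" and "c = 4 / d\<^sup>2" and "b = 4 * s / d\<^sup>2"
    and "v = (1 + \<gamma>) * lam"
  have gl: "0 < lam * \<gamma>" "lam * \<gamma> < lam" using lam \<gamma> by simp_all
  then have d: "d > 0" "s = d + lam" using lam by (auto simp: d_def s_def)
  then have c: "c > 0" "c * d\<^sup>2 = 4" "b = c * s" by (auto simp: c_def b_def)
  have v: "v = s + lam - 1" by (simp add: v_def s_def algebra_simps)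
  \<comment> \<open>The range of \<open>lam\<close> enters here: the bound at 0 reads
    \<open>4 * s * lam \<le> (s - lam)\<^sup>2\<close>, a quadratic inequality in \<open>s\<close>
    with roots \<open>(3 + 2 * sqrt 2) * lam\<close> and
    \<open>(3 - 2 * sqrt 2) * lam\<close>.\<close>
  have b_le: "b * lam \<le> 1"
  proof -
    have "(3 + 2 * sqrt 2) * lam \<le> s"
      using small by (simp add: s_def algebra_simps)
    moreover have "(3 - 2 * sqrt 2) * lam \<le> (3 + 2 * sqrt 2) * lam"
      using lam by (intro mult_right_mono) auto
    ultimately have "0 \<le> (s - (3 + 2 * sqrt 2) * lam) * (s - (3 - 2 * sqrt 2) * lam)"
      by simp
    also have "\<dots> = (s - lam)\<^sup>2 - 4 * s * lam"
      by (simp add: power2_eq_square algebra_simps)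
    finally show ?thesis using d by (simp add: b_def)
  qed
  have "(b - c * lam)\<^sup>2 \<le> 4 * c"
  proof -
    have "(b - c * lam)\<^sup>2 = (c * d\<^sup>2) * c"
      unfolding c(3) d(2) by (simp add: power2_eq_square algebra_simps)
    then show ?thesis using c(2) by simp
  qed
  note le_1 = quad_le_1[OF c(1) this]
  have b_ge: "c * (1 + lam * \<gamma>) \<le> b" by (simp add: c(3) s_def)
  have best: "b' - c' * v < b - c * v \<or> b' = b \<and> c' = c"
    if adm: "admissible lam \<gamma> (quad lam b' c')" for b' c'
  proof -
    note D = admissible_quadD[OF adm lam \<gamma>]
    \<comment> \<open>The vertex of the candidate, where the upper bound 1 is tight.\<close>
    define m where "m = (s + lam) / 2"
    have "(m - lam) * (b' - c' * m) \<le> 1"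
      using lam gl by (intro D(3)) (auto simp: m_def s_def algebra_simps)
    moreover have "m - lam = d / 2" by (simp add: m_def d(2) field_simps)
    ultimately have "d * (b' - c' * m) \<le> 2" by simp
    also have "2 = d * (b - c * m)"
      using c(2) by (simp add: c(3) m_def d(2) power2_eq_square algebra_simps)
    finally have peak: "b' - c' * m \<le> b - c * m" using d(1) by simp
    have at_1: "c' * s \<le> b'" using D(2) by (simp add: s_def)
    \<comment> \<open>The constraint at \<open>s\<close> bounds from below, so
      \<open>two_constraints_max\<close> does not apply. Instead both constraints give
      \<open>c' \<le> c\<close>, and passing from \<open>m\<close> to \<open>v\<close> adds
      \<open>c' * (m - v)\<close>, which increases with \<open>c'\<close>.\<close>
    have "(c' - c) * (s - m) \<le> 0"
      using peak at_1 by (simp add: c(3) algebra_simps)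
    moreover have "s - m > 0" using d by (simp add: m_def field_simps)
    ultimately have "c' \<le> c" by (simp add: mult_le_0_iff)
    have "m - v > 0"
      using lam gl by (simp add: m_def v s_def field_simps)
    show ?thesis
    proof (cases "c' = c")
      case True
      with peak show ?thesis by auto
    next
      case False
      with \<open>c' \<le> c\<close> have "c' * (m - v) < c * (m - v)"
        using \<open>m - v > 0\<close> by (intro mult_strict_right_mono) auto
      with peak show ?thesis by (simp add: algebra_simps)
    qed
  qed
  have opt: "\<exists>!q. is_optimal_poly 2 lam \<gamma> q" "optimal_poly 2 lam \<gamma> = quad lam b c"
    "optimal_gap 2 lam \<gamma> = \<gamma> * lam * (b - c * v)"
    unfolding v_def by (rule optimal_quad[OF lam \<gamma> c(1) b_le b_ge]; use le_1 best[unfolded v_def] in blast)+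
  show "\<exists>!q. is_optimal_poly 2 lam \<gamma> q" by (fact opt(1))
  show "optimal_poly 2 lam \<gamma> = quad lam (4 * (1 + lam * \<gamma>) / d\<^sup>2) (4 / d\<^sup>2)"
    using opt(2) unfolding b_def c_def s_def .
  have "b - c * v = 4 * (1 - lam) / d\<^sup>2"
    unfolding c(3) v c_def using d(1) by (simp add: divide_simps)
  then show "optimal_gap 2 lam \<gamma> = 4 * \<gamma> * lam * (1 - lam) / d\<^sup>2"
    unfolding opt(3) by simp
qed

text \<open>The value -1 at 0 fixes the first coefficient and tangency to 1 the second. The other
  root is \<open>(3 + 2 * sqrt 2) * lam\<close>; the lower bound on \<open>lam\<close> puts it at or
  beyond \<open>1 + lam * \<gamma>\<close>, and the upper bound puts the vertex at or before
  1.\<close>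

lemma optimal_quad_medium:
  fixes lam \<gamma> :: real
  assumes lam: "0 < lam" "lam < 1 / 2" and \<gamma>: "0 < \<gamma>" "\<gamma> < 1"
    and lower: "1 \<le> (3 + 2 * sqrt 2 - \<gamma>) * lam" and upper: "lam \<le> 1 - sqrt 2 / 2"
  shows "\<exists>!q. is_optimal_poly 2 lam \<gamma> q"
    and "optimal_poly 2 lam \<gamma> = quad lam (1 / lam) (1 / ((3 + 2 * sqrt 2) * lam\<^sup>2))"
    and "optimal_gap 2 lam \<gamma> = \<gamma> / (3 + 2 * sqrt 2) * (2 + 2 * sqrt 2 - \<gamma>)"
proof -
  define k c b v where "k = 3 + 2 * sqrt 2" and "c = 1 / (k * lam\<^sup>2)" and "b = 1 / lam"
    and "v = (1 + \<gamma>) * lam"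
  \<comment> \<open>With \<open>c = 1 / (k * lam\<^sup>2)\<close>, tangency
    \<open>(b - c * lam)\<^sup>2 = 4 * c\<close> becomes this equation, of which \<open>k\<close> is
    the larger root.\<close>
  have k: "k > 0" "(k - 1)\<^sup>2 = 4 * k"
    by (simp_all add: k_def power2_eq_square algebra_simps add_pos_pos)
  have c: "c > 0" using k lam by (simp add: c_def)
  have b_ge: "c * (1 + lam * \<gamma>) \<le> b"
  proof -
    have "1 + lam * \<gamma> \<le> k * lam" using lower by (simp add: k_def algebra_simps)
    then have "c * (1 + lam * \<gamma>) \<le> c * (k * lam)" using c by simp
    also have "\<dots> = b" using k lam by (simp add: c_def b_def power2_eq_square)
    finally show ?thesis .
  qed
  have "(b - c * lam)\<^sup>2 \<le> 4 * c"
  proof -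
    have "b - c * lam = (k - 1) / (k * lam)"
      using k lam by (simp add: c_def b_def field_simps power2_eq_square)
    then have "(b - c * lam)\<^sup>2 = 4 * k / (k * lam)\<^sup>2"
      by (simp add: power_divide k(2))
    also have "\<dots> = 4 * c"
      using k lam by (simp add: c_def field_simps power2_eq_square)
    finally show ?thesis by simp
  qed
  note le_1 = quad_le_1[OF c this]
  have best: "b' - c' * v < b - c * v \<or> b' = b \<and> c' = c"
    if adm: "admissible lam \<gamma> (quad lam b' c')" for b' c'
  proof -
    note D = admissible_quadD[OF adm lam \<gamma>]
    \<comment> \<open>The vertex: the midpoint of the roots \<open>lam\<close> and
      \<open>k * lam\<close>.\<close>
    define m where "m = (2 + sqrt 2) * lam"
    have "(2 + sqrt 2) * lam \<le> (2 + sqrt 2) * (1 - sqrt 2 / 2)"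
      using upper by (intro mult_left_mono) auto
    also have "\<dots> = 1" by (simp add: field_simps)
    finally have "m \<le> 1" by (simp add: m_def)
    have "1 + \<gamma> < 2 + sqrt 2"
      using \<gamma>(2) real_sqrt_ge_zero[of 2] by linarith
    then have "v < m"
      unfolding v_def m_def using lam(1) by (rule mult_strict_right_mono)
    then have "(m - lam) * (b' - c' * m) \<le> 1"
      using \<open>m \<le> 1\<close> by (intro D(3)) (auto simp: v_def)
    also have "1 = (m - lam) * (b - c * m)"
    proof -
      have "b - c * m = (k - (2 + sqrt 2)) / (k * lam)"
        using k(1) lam by (simp add: c_def b_def m_def field_simps power2_eq_square)
      \<comment> \<open>Both factors equal \<open>1 + sqrt 2\<close>, whose square is
        \<open>k\<close>.\<close>
      moreover have "(1 + sqrt 2) * (k - (2 + sqrt 2)) = k"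
        by (simp add: k_def algebra_simps)
      moreover have "m - lam = (1 + sqrt 2) * lam"
        by (simp add: m_def algebra_simps)
      ultimately have "(m - lam) * (b - c * m) = k * lam / (k * lam)"
        by (simp add: mult.assoc[symmetric] mult.commute mult.left_commute)
      then show ?thesis using k lam by simp
    qed
    finally have "b' - c' * m \<le> b - c * m"
      by (rule mult_left_le_imp_le) (use lam in \<open>simp add: m_def algebra_simps add_pos_pos\<close>)
    moreover have "b' - c' * 0 \<le> b - c * 0"
      using D(1) lam by (simp add: b_def field_simps)
    moreover have "0 < v" using lam \<gamma> by (simp add: v_def)
    ultimately show ?thesis using \<open>v < m\<close> two_constraints_max by blast
  qed
  have b_le: "b * lam \<le> 1" using lam by (simp add: b_def)
  have opt: "\<exists>!q. is_optimal_poly 2 lam \<gamma> q" "optimal_poly 2 lam \<gamma> = quad lam b c"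
    "optimal_gap 2 lam \<gamma> = \<gamma> * lam * (b - c * v)"
    unfolding v_def by (rule optimal_quad[OF lam \<gamma> c b_le b_ge]; use le_1 best[unfolded v_def] in blast)+
  show "\<exists>!q. is_optimal_poly 2 lam \<gamma> q" by (fact opt(1))
  show "optimal_poly 2 lam \<gamma> = quad lam (1 / lam) (1 / ((3 + 2 * sqrt 2) * lam\<^sup>2))"
    using opt(2) unfolding b_def c_def k_def .
  have "lam * (b - c * v) = (k - 1 - \<gamma>) / k"
    using lam k(1) by (simp add: b_def c_def v_def field_simps power2_eq_square)
  then have "optimal_gap 2 lam \<gamma> = \<gamma> / k * (k - 1 - \<gamma>)"
    unfolding opt(3) by (simp add: mult.assoc)
  then show "optimal_gap 2 lam \<gamma> = \<gamma> / (3 + 2 * sqrt 2) * (2 + 2 * sqrt 2 - \<gamma>)"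
    by (simp add: k_def)
qed

text \<open>The candidate takes the values -1 at 0 and 1 at 1. In this range its vertex is at or
  beyond 1, so it increases up to 1 and stays below the bound.\<close>

lemma optimal_quad_large:
  fixes lam \<gamma> :: real
  assumes lam: "0 < lam" "lam < 1 / 2" and \<gamma>: "0 < \<gamma>" "\<gamma> < 1"
    and lower: "1 - sqrt 2 / 2 \<le> lam"
  shows "\<exists>!q. is_optimal_poly 2 lam \<gamma> q"
    and "optimal_poly 2 lam \<gamma> = quad lam (1 / lam) ((1 - 2 * lam) / ((1 - lam) * lam))"
    and "optimal_gap 2 lam \<gamma> = lam * (2 * lam - 1) * \<gamma> * (1 + \<gamma>) / (1 - lam) + \<gamma>"
proof -
  define c b v where "c = (1 - 2 * lam) / ((1 - lam) * lam)" and "b = 1 / lam"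
    and "v = (1 + \<gamma>) * lam"
  have c: "c > 0" using lam by (simp add: c_def)
  have bc: "b - c = 1 / (1 - lam)" using lam by (simp add: b_def c_def field_simps)
  have v: "0 < v" "v < 1"
  proof -
    have "\<gamma> * lam < lam" using lam \<gamma> by simp
    then show "v < 1" using lam(2) by (simp only: v_def distrib_right)
  qed (use lam \<gamma> in \<open>simp add: v_def\<close>)
  \<comment> \<open>The vertex is at \<open>(b + c * lam) / (2 * c)\<close>; that it is at least 1
    amounts to \<open>2 * (1 - lam)\<^sup>2 \<le> 1\<close>.\<close>
  have vertex: "2 * c \<le> b + c * lam"
  proof -
    have "(1 - lam)\<^sup>2 \<le> (sqrt 2 / 2)\<^sup>2"
      using lower lam by (intro power_mono) auto
    then have "(2 - lam) * (1 - 2 * lam) \<le> 1 - lam"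
      by (simp add: power2_eq_square algebra_simps)
    then have "(2 - lam) * (1 - 2 * lam) / ((1 - lam) * lam) \<le> (1 - lam) / ((1 - lam) * lam)"
      using lam by (intro divide_right_mono) auto
    also have "(2 - lam) * (1 - 2 * lam) / ((1 - lam) * lam) = (2 - lam) * c" by (simp add: c_def)
    also have "(1 - lam) / ((1 - lam) * lam) = b" using lam by (simp add: b_def)
    finally show ?thesis by (simp add: algebra_simps)
  qed
  have b_ge: "c * (1 + lam * \<gamma>) \<le> b"
  proof -
    have "c * (1 + v) \<le> c * 2" using v c by simp
    then show ?thesis using vertex by (simp add: v_def algebra_simps)
  qed
  have le_1: "(x - lam) * (b - c * x) \<le> 1" if "x \<le> 1" for x
  proof -
    have "c * (x + 1) \<le> c * 2" using that c by simp
    then have "0 \<le> (1 - x) * (b + c * lam - c * (x + 1))"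
      using vertex that by simp
    then have "(x - lam) * (b - c * x) \<le> (1 - lam) * (b - c)"
      by (simp add: algebra_simps)
    then show ?thesis using lam by (simp add: bc)
  qed
  have best: "b' - c' * v < b - c * v \<or> b' = b \<and> c' = c"
    if adm: "admissible lam \<gamma> (quad lam b' c')" for b' c'
  proof -
    note D = admissible_quadD[OF adm lam \<gamma>]
    have "(1 - lam) * (b' - c' * 1) \<le> 1"
      using v by (intro D(3)) (auto simp: v_def)
    also have "1 = (1 - lam) * (b - c * 1)" using lam by (simp add: bc)
    finally have "b' - c' * 1 \<le> b - c * 1"
      by (rule mult_left_le_imp_le) (use lam in simp)
    moreover have "b' - c' * 0 \<le> b - c * 0"
      using D(1) lam by (simp add: b_def field_simps)
    ultimately show ?thesis using v two_constraints_max by blast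
  qed
  have b_le: "b * lam \<le> 1" using lam by (simp add: b_def)
  have opt: "\<exists>!q. is_optimal_poly 2 lam \<gamma> q" "optimal_poly 2 lam \<gamma> = quad lam b c"
    "optimal_gap 2 lam \<gamma> = \<gamma> * lam * (b - c * v)"
    unfolding v_def by (rule optimal_quad[OF lam \<gamma> c b_le b_ge]; use le_1 best[unfolded v_def] in blast)+
  show "\<exists>!q. is_optimal_poly 2 lam \<gamma> q" by (fact opt(1))
  show "optimal_poly 2 lam \<gamma> = quad lam (1 / lam) ((1 - 2 * lam) / ((1 - lam) * lam))"
    using opt(2) unfolding b_def c_def .
  show "optimal_gap 2 lam \<gamma> = lam * (2 * lam - 1) * \<gamma> * (1 + \<gamma>) / (1 - lam) + \<gamma>"
    unfolding opt(3) using lam by (simp add: b_def c_def v_def field_simps)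
qed

theorem theorem5:
  fixes lam \<gamma> :: real
  assumes "0 < lam" and "lam < 1 / 2" and "0 < \<gamma>" and "\<gamma> < 1"
  shows "(\<exists>!p. is_optimal_poly 2 lam \<gamma> p) \<and>
    (lam \<in> {0<..1 / (3 + 2 * sqrt 2 - \<gamma>)} \<longrightarrow>
       optimal_poly 2 lam \<gamma> =
         [:- lam, 1:] * [:4 * (1 + lam * \<gamma>) / (1 - lam + lam * \<gamma>)\<^sup>2, - 4 / (1 - lam + lam * \<gamma>)\<^sup>2:] \<and>
       optimal_gap 2 lam \<gamma> = 4 * \<gamma> * lam * (1 - lam) / (1 + lam * \<gamma> - lam)\<^sup>2) \<and>
    (lam \<in> {1 / (3 + 2 * sqrt 2 - \<gamma>)..1 - sqrt 2 / 2} \<longrightarrow>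
       optimal_poly 2 lam \<gamma> =
         [:- lam, 1:] * [:1 / lam, - 1 / ((3 + 2 * sqrt 2) * lam\<^sup>2):] \<and>
       optimal_gap 2 lam \<gamma> = \<gamma> / (3 + 2 * sqrt 2) * (2 + 2 * sqrt 2 - \<gamma>)) \<and>
    (lam \<in> {1 - sqrt 2 / 2..<1 / 2} \<longrightarrow>
       optimal_poly 2 lam \<gamma> =
         [:- lam, 1:] * [:1 / lam, (2 * lam - 1) / ((1 - lam) * lam):] \<and>
       optimal_gap 2 lam \<gamma> = lam * (2 * lam - 1) * \<gamma> * (1 + \<gamma>) / (1 - lam) + \<gamma>)"
proof -
  have pos: "0 < 3 + 2 * sqrt 2 - \<gamma>"
    using assms real_sqrt_ge_zero[of 2] by linarith
  have iff: "lam \<le> 1 / (3 + 2 * sqrt 2 - \<gamma>) \<longleftrightarrow> (3 + 2 * sqrt 2 - \<gamma>) * lam \<le> 1"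
    "1 / (3 + 2 * sqrt 2 - \<gamma>) \<le> lam \<longleftrightarrow> 1 \<le> (3 + 2 * sqrt 2 - \<gamma>) * lam"
    using pos by (simp_all add: field_simps)
  \<comment> \<open>Brings the stated coefficients into the form \<open>- c\<close> used by
    \<open>quad\<close>.\<close>
  have neg: "(2 * lam - 1) / ((1 - lam) * lam) = - ((1 - 2 * lam) / ((1 - lam) * lam))"
    "1 + lam * \<gamma> - lam = 1 - lam + lam * \<gamma>"
    by (simp_all only: minus_divide_left minus_diff_eq)
  \<comment> \<open>The ranges share endpoints, where both formulas are asserted; this is consistent
    because each range lemma includes its endpoints.\<close>
  consider "(3 + 2 * sqrt 2 - \<gamma>) * lam \<le> 1"
    | "1 \<le> (3 + 2 * sqrt 2 - \<gamma>) * lam" "lam \<le> 1 - sqrt 2 / 2"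
    | "1 - sqrt 2 / 2 \<le> lam"
    by linarith
  then have "\<exists>!p. is_optimal_poly 2 lam \<gamma> p"
    using optimal_quad_small(1) optimal_quad_medium(1) optimal_quad_large(1) assms by cases metis+
  then show ?thesis
    unfolding neg greaterThanAtMost_iff atLeastAtMost_iff atLeastLessThan_iff iff minus_divide_left[symmetric]
    using optimal_quad_small(2,3)[OF assms] optimal_quad_medium(2,3)[OF assms]
      optimal_quad_large(2,3)[OF assms]
    by (intro conjI impI) auto
qed

end
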